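(* Let $(X,d_X)$ and $(Y,d_Y)$ be unbounded chain-connected proper metric spaces. Then $\mathscr{I}_{\mathcal{SO}}(Y,X)$ is a subset of $\mathscr{I}_{\mathcal{SO}^{\ast}}(Y,X)$, in the sense that $T\mapsto T|_{\mathcal{SO}^{\ast}(Y)}$ is a well-defined injection $\mathscr{I}_{\mathcal{SO}}(Y,X)\to\mathscr{I}_{\mathcal{SO}^{\ast}}(Y,X)$. In particular, $\mathcal{SO}_{\sharp}(X)$ is a sublattice of $\mathcal{SO}_{\sharp}^{\ast}(X)$.
   Context: A metric space is proper if all its closed balls are compact. For $r>0$, $X$ is $r$-chain connected if for any $x,x'\in X$ there are finitely many points $p_0=x,p_1,\dots,p_n=x'$ in $X$ with $d_X(p_{i-1},p_i)\le r$ for $i=1,\dots,n$; $X$ is chain-connected if it is $r$-chain connected for some $r>0$. A continuous $f:X\to\mathbb{R}$ on a proper metric space is slowly oscillating if for every $R>0$ and $\varepsilon>0$ there is a compact $K\subset X$ with $\operatorname{diam} f(B_{d_X}(x,R))<\varepsilon$ for every $x\in X\setminus K$, where $B_{d_X}(x,R)$ is the closed ball. $\mathcal{SO}(X)$ is the vector lattice (pointwise $\wedge=\min$, $\vee=\max$) of all continuous slowly oscillating functions $X\to\mathbb{R}$ and $\mathcal{SO}^{\ast}(X)$ the sublattice of bounded ones. $\mathscr{I}_{\mathcal{SO}}(Y,X)$ (resp. $\mathscr{I}_{\mathcal{SO}^{\ast}}(Y,X)$) is the set of all linear lattice isomorphisms, i.e. linear bijections preserving $\vee$ and $\wedge$,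 from $\mathcal{SO}(Y)$ onto $\mathcal{SO}(X)$ (resp. from $\mathcal{SO}^{\ast}(Y)$ onto $\mathcal{SO}^{\ast}(X)$). $\mathcal{SO}_{\sharp}(X)$ is the set of $\omega\in\mathcal{SO}(X)$ such that $\omega>0$ everywhere and, for every $f\in\mathcal{SO}(X)$, $\omega\cdot f\in\mathcal{SO}(X)$ and $(1/\omega)\cdot f\in\mathcal{SO}(X)$. $\mathcal{SO}_{\sharp}^{\ast}(X)$ is the set of $\omega\in\mathcal{SO}^{\ast}(X)$ such that $\omega>0$ everywhere and, for every $f\in\mathcal{SO}^{\ast}(X)$, $\omega\cdot f\in\mathcal{SO}^{\ast}(X)$ and $(1/\omega)\cdot f\in\mathcal{SO}^{\ast}(X)$. Sublattice means a subset closed under $\wedge$ and $\vee$. *)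

theory Defs
  imports "HOL-Analysis.Analysis"
begin

text \<open>A metric space is a type of class \<^class>\<open>metric_space\<close>; the space itself is \<^term>\<open>UNIV\<close>.\<close>

definition proper_space :: "'a::metric_space itself \<Rightarrow> bool" where
  "proper_space _ \<longleftrightarrow> (\<forall>(x::'a) r. compact (cball x r))"

definition r_chain_connected :: "'a::metric_space itself \<Rightarrow> real \<Rightarrow> bool" where
  "r_chain_connected _ r \<longleftrightarrow>
     (\<forall>x x'::'a. \<exists>(n::nat) (p::nat \<Rightarrow> 'a).
        p 0 = x \<and> p n = x' \<and> (\<forall>i\<in>{1..n}. dist (p (i - 1)) (p i) \<le> r))"

definition chain_connected :: "'a::metric_space itself \<Rightarrow> bool" where
  "chain_connected X \<longleftrightarrow> (\<exists>r>0. r_chain_connected X r)"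

text \<open>\<^const>\<open>diameter\<close> is a real supremum, hence unspecified on unbounded sets. On a proper space
  this does not matter here: the continuous image of a closed ball is compact.\<close>

definition slowly_oscillating :: "('a::metric_space \<Rightarrow> real) \<Rightarrow> bool" where
  "slowly_oscillating f \<longleftrightarrow>
     (\<forall>R>0. \<forall>\<epsilon>>0. \<exists>K. compact K \<and> (\<forall>x\<in>- K. diameter (f ` cball x R) < \<epsilon>))"

definition SO :: "('a::metric_space \<Rightarrow> real) set" where
  "SO = {f. continuous_on UNIV f \<and> slowly_oscillating f}"

definition SO_bdd :: "('a::metric_space \<Rightarrow> real) set" where
  "SO_bdd = {f \<in> SO. bounded (range f)}"

text \<open>Maps with domain \<open>A\<close> are represented extensionally (\<^term>\<open>undefined\<close> off \<open>A\<close>), so that two of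
  them are equal as soon as they agree on \<open>A\<close>.\<close>

definition lattice_isos ::
  "('b \<Rightarrow> real) set \<Rightarrow> ('a \<Rightarrow> real) set \<Rightarrow> (('b \<Rightarrow> real) \<Rightarrow> ('a \<Rightarrow> real)) set" where
  "lattice_isos A B = {T \<in> A \<rightarrow>\<^sub>E B. bij_betw T A B \<and>
     (\<forall>f\<in>A. \<forall>g\<in>A. T (\<lambda>y. f y + g y) = (\<lambda>x. T f x + T g x)) \<and>
     (\<forall>c. \<forall>f\<in>A. T (\<lambda>y. c * f y) = (\<lambda>x. c * T f x)) \<and>
     (\<forall>f\<in>A. \<forall>g\<in>A. T (\<lambda>y. max (f y) (g y)) = (\<lambda>x. max (T f x) (T g x))) \<and>
     (\<forall>f\<in>A. \<forall>g\<in>A. T (\<lambda>y. min (f y) (g y)) = (\<lambda>x. min (T f x) (T g x)))}"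

definition SO_isos ::
  "(('b::metric_space \<Rightarrow> real) \<Rightarrow> ('a::metric_space \<Rightarrow> real)) set" where
  "SO_isos = lattice_isos SO SO"

definition SO_bdd_isos ::
  "(('b::metric_space \<Rightarrow> real) \<Rightarrow> ('a::metric_space \<Rightarrow> real)) set" where
  "SO_bdd_isos = lattice_isos SO_bdd SO_bdd"

definition sharp :: "('a \<Rightarrow> real) set \<Rightarrow> ('a \<Rightarrow> real) set" where
  "sharp A = {\<omega> \<in> A. (\<forall>x. \<omega> x > 0) \<and>
     (\<forall>f\<in>A. (\<lambda>x. \<omega> x * f x) \<in> A \<and> (\<lambda>x. (1 / \<omega> x) * f x) \<in> A)}"

definition SO_sharp :: "('a::metric_space \<Rightarrow> real) set" where
  "SO_sharp = sharp SO"

definition SO_bdd_sharp :: "('a::metric_space \<Rightarrow> real) set" where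
  "SO_bdd_sharp = sharp SO_bdd"

definition sublattice_of :: "('a \<Rightarrow> real) set \<Rightarrow> ('a \<Rightarrow> real) set \<Rightarrow> bool" where
  "sublattice_of A B \<longleftrightarrow> A \<subseteq> B \<and>
     (\<forall>f\<in>A. \<forall>g\<in>A. (\<lambda>x. min (f x) (g x)) \<in> A \<and> (\<lambda>x. max (f x) (g x)) \<in> A)"

end

theory Submission
  imports Defs
begin

text \<open>Everything follows from a description of the isomorphisms: each \<open>T\<close> in
  \<^const>\<open>SO_isos\<close> is a weighted composition operator
  \<open>T f x = w x * f (\<tau> x)\<close> whose weight \<open>w = T 1\<close> is everywhere positive and bounded.

  For the description, fix \<open>x\<close> and consider the real lattice homomorphism
  \<open>\<phi> f = T f x\<close>. The unbounded functions in \<^const>\<open>SO\<close> rule out all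
  homomorphisms that live at infinity. First, \<open>\<phi> 1 = 0\<close> would force \<open>\<phi> = 0\<close>, because every
  slowly oscillating \<open>f\<close> is dominated superlinearly by a slowly oscillating \<open>g\<close>, so that
  \<open>\<phi> g \<ge> N * \<phi> f\<close> for all \<open>N\<close> (\<open>functional_one_pos\<close>). Second, \<open>ln (1 + dist p x)\<close> is slowly
  oscillating and tends to infinity; its image under \<open>\<phi>\<close> is finite, and this localises \<open>\<phi>\<close> on a
  compact ball, where the usual covering argument yields a point of evaluation
  (\<open>functional_point_evaluation\<close>).

  Chain connectedness enters in the boundedness of \<open>w\<close> (\<open>SO_isos_weight_bounded\<close>): in
  a space with more than one point, every point has another one within a fixed distance \<open>r\<close>. If \<open>w\<close> were unbounded, there would be
  pairs \<open>x n \<noteq> x' n\<close> at distance at most \<open>r\<close> with \<open>w (x n) \<rightarrow> \<infinity>\<close>. A sum of bumps of height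
  \<open>1 / w (x n)\<close> at the points \<open>\<tau> (x n)\<close>, vanishing at all \<open>\<tau> (x' n)\<close>, is slowly oscillating
  since it vanishes at infinity; but its image under \<open>T\<close> is at least 1 at \<open>x n\<close> and 0 at \<open>x' n\<close>.

  Given this, \<open>T\<close> and its inverse preserve boundedness, and \<open>T\<close> is determined by its values on
  bounded functions because the value \<open>T f x\<close> depends on a single value of \<open>f\<close>, which does not
  change when \<open>f\<close> is truncated at a high level. The statement on multipliers is the case where
  \<open>T\<close> is multiplication by \<open>\<omega>\<close>.\<close>

section \<open>Slowly oscillating functions\<close>

lemma compact_cball_proper:
  fixes x :: "'a::metric_space"
  assumes "proper_space TYPE('a)"
  shows "compact (cball x r)"
  using assms by (auto simp: proper_space_def)

text \<open>On a proper space the diameters in the definition are taken of compact sets, so they control,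
  and are controlled by, the distances from the value at the centre. This form avoids suprema.\<close>

lemma SO_iff:
  fixes f :: "'a::metric_space \<Rightarrow> real"
  assumes P: "proper_space TYPE('a)"
  shows "f \<in> SO \<longleftrightarrow> continuous_on UNIV f \<and>
    (\<forall>R>0. \<forall>e>0. \<exists>K. compact K \<and> (\<forall>x\<in>-K. \<forall>y. dist x y \<le> R \<longrightarrow> \<bar>f x - f y\<bar> < e))"
    (is "_ \<longleftrightarrow> _ \<and> ?osc")
proof (cases "continuous_on UNIV f")
  case True
  have bnd: "bounded (f ` cball x R)" for x R
    using compact_cball_proper[OF P] True
    by (intro compact_imp_bounded compact_continuous_image) (auto intro: continuous_on_subset)
  have "slowly_oscillating f \<longleftrightarrow> ?osc"
  proof (intro iffI allI impI)
    fix R e :: real assume so: "slowly_oscillating f" and "R > 0" "e > 0"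
    then obtain K where K: "compact K" "\<forall>x\<in>-K. diameter (f ` cball x R) < e"
      unfolding slowly_oscillating_def by blast
    have "\<bar>f x - f y\<bar> < e" if "x \<in> -K" "dist x y \<le> R" for x y
    proof -
      have "dist (f x) (f y) \<le> diameter (f ` cball x R)"
        using that \<open>R > 0\<close> by (intro diameter_bounded_bound bnd) auto
      then show ?thesis
        using K that by (force simp: dist_real_def)
    qed
    then show "\<exists>K. compact K \<and> (\<forall>x\<in>-K. \<forall>y. dist x y \<le> R \<longrightarrow> \<bar>f x - f y\<bar> < e)"
      using K(1) by blast
  next
    assume osc: ?osc
    show "slowly_oscillating f" unfolding slowly_oscillating_def
    proof (intro allI impI)
      fix R e :: real assume "R > 0" "e > 0"
      then obtain K where K: "compact K" "\<forall>x\<in>-K. \<forall>y. dist x y \<le> R \<longrightarrow> \<bar>f x - f y\<bar> < e / 4"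
        using osc[rule_format, of R "e/4"] by auto
      have "diameter (f ` cball x R) < e" if "x \<in> -K" for x
      proof -
        have "diameter (f ` cball x R) \<le> e / 2"
        proof (rule diameter_le)
          fix u v assume "u \<in> f ` cball x R" "v \<in> f ` cball x R"
          then have "\<bar>f x - u\<bar> < e/4" "\<bar>f x - v\<bar> < e/4" using K that by auto
          then show "norm (u - v) \<le> e / 2" unfolding real_norm_def by linarith
        qed (use \<open>e > 0\<close> in auto)
        then show ?thesis using \<open>e > 0\<close> by simp
      qed
      then show "\<exists>K. compact K \<and> (\<forall>x\<in>-K. diameter (f ` cball x R) < e)"
        using K(1) by blast
    qed
  qed
  then show ?thesis using True by (simp add: SO_def)
qed (simp add: SO_def)

lemma SO_continuous: "f \<in> SO \<Longrightarrow> continuous_on UNIV f"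
  by (simp add: SO_def)

lemma SO_oscE:
  fixes f :: "'a::metric_space \<Rightarrow> real"
  assumes "proper_space TYPE('a)" "f \<in> SO" "R > 0" "e > 0"
  obtains K where "compact K" "\<And>x y. x \<notin> K \<Longrightarrow> dist x y \<le> R \<Longrightarrow> \<bar>f x - f y\<bar> < e"
  using assms SO_iff[OF assms(1), of f] by (metis ComplI)

lemma SO_I:
  fixes f :: "'a::metric_space \<Rightarrow> real"
  assumes "proper_space TYPE('a)" "continuous_on UNIV f"
    and "\<And>R e. R > 0 \<Longrightarrow> e > 0 \<Longrightarrow>
      \<exists>K. compact K \<and> (\<forall>x y. x \<notin> K \<longrightarrow> dist x y \<le> R \<longrightarrow> \<bar>f x - f y\<bar> < e)"
  shows "f \<in> SO"
  using assms SO_iff[OF assms(1), of f] by (metis ComplD)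

text \<open>A single closure property from which closure under the vector lattice operations is read off:
  each of them has oscillation bounded by a multiple of the oscillations of its arguments.\<close>

lemma SO_dominated:
  fixes f g h :: "'a::metric_space \<Rightarrow> real"
  assumes P: "proper_space TYPE('a)" and f: "f \<in> SO" and g: "g \<in> SO"
    and h: "continuous_on UNIV h"
    and le: "\<And>x y. \<bar>h x - h y\<bar> \<le> C * (\<bar>f x - f y\<bar> + \<bar>g x - g y\<bar>)"
  shows "h \<in> SO"
proof (rule SO_I[OF P h])
  fix R e :: real assume Re: "R > 0" "e > 0"
  define d where "d = e / (2 * (\<bar>C\<bar> + 1))"
  have d: "d > 0" using Re by (simp add: d_def)
  obtain K where K: "compact K" "\<And>x y. x \<notin> K \<Longrightarrow> dist x y \<le> R \<Longrightarrow> \<bar>f x - f y\<bar> < d"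
    using SO_oscE[OF P f Re(1) d] by blast
  obtain L where L: "compact L" "\<And>x y. x \<notin> L \<Longrightarrow> dist x y \<le> R \<Longrightarrow> \<bar>g x - g y\<bar> < d"
    using SO_oscE[OF P g Re(1) d] by blast
  have "\<bar>h x - h y\<bar> < e" if "x \<notin> K \<union> L" "dist x y \<le> R" for x y
  proof -
    have "\<bar>h x - h y\<bar> \<le> C * (\<bar>f x - f y\<bar> + \<bar>g x - g y\<bar>)" by (rule le)
    also have "\<dots> \<le> (\<bar>C\<bar> + 1) * (\<bar>f x - f y\<bar> + \<bar>g x - g y\<bar>)"
      by (intro mult_right_mono) auto
    also have "\<dots> < (\<bar>C\<bar> + 1) * (d + d)"
      using K(2)[of x y] L(2)[of x y] that by (intro mult_strict_left_mono add_strict_mono) auto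
    also have "\<dots> = e"
    proof -
      have "(\<bar>C\<bar> + 1) * (d + d) = 2 * (\<bar>C\<bar> + 1) * d" by (simp add: algebra_simps)
      also have "\<dots> = e"
      proof -
        have "2 * (\<bar>C\<bar> + 1) \<noteq> 0" using abs_ge_zero[of C] by argo
        then show ?thesis unfolding d_def times_divide_eq_right by (rule nonzero_mult_div_cancel_left)
      qed
      finally show ?thesis .
    qed
    finally show ?thesis .
  qed
  then show "\<exists>K. compact K \<and> (\<forall>x y. x \<notin> K \<longrightarrow> dist x y \<le> R \<longrightarrow> \<bar>h x - h y\<bar> < e)"
    using K(1) L(1) compact_Un by metis
qed

context
  assumes P: "proper_space TYPE('a::metric_space)"
begin

lemma SO_const: "(\<lambda>_::'a. c) \<in> SO"
  by (rule SO_I[OF P]) auto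

lemma SO_add: "(\<lambda>x::'a. f x + g x) \<in> SO" if "f \<in> SO" "g \<in> SO"
proof (rule SO_dominated[OF P that])
  show "continuous_on UNIV (\<lambda>x. f x + g x)"
    using that by (intro continuous_on_add SO_continuous)
  show "\<bar>(f x + g x) - (f y + g y)\<bar> \<le> 1 * (\<bar>f x - f y\<bar> + \<bar>g x - g y\<bar>)" for x y
    by (smt (verit))
qed

lemma SO_scale: "(\<lambda>x::'a. c * f x) \<in> SO" if "f \<in> SO"
proof (rule SO_dominated[OF P that that])
  show "continuous_on UNIV (\<lambda>x. c * f x)"
    using that by (intro continuous_on_mult_left SO_continuous)
  show "\<bar>c * f x - c * f y\<bar> \<le> \<bar>c\<bar> * (\<bar>f x - f y\<bar> + \<bar>f x - f y\<bar>)" for x y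
    by (simp add: abs_mult mult_left_mono flip: right_diff_distrib)
qed

lemma SO_max: "(\<lambda>x::'a. max (f x) (g x)) \<in> SO" if "f \<in> SO" "g \<in> SO"
proof (rule SO_dominated[OF P that])
  show "continuous_on UNIV (\<lambda>x. max (f x) (g x))"
    using that by (intro continuous_on_max SO_continuous)
  show "\<bar>max (f x) (g x) - max (f y) (g y)\<bar> \<le> 1 * (\<bar>f x - f y\<bar> + \<bar>g x - g y\<bar>)" for x y
    by (smt (verit))
qed

lemma SO_min: "(\<lambda>x::'a. min (f x) (g x)) \<in> SO" if "f \<in> SO" "g \<in> SO"
proof (rule SO_dominated[OF P that])
  show "continuous_on UNIV (\<lambda>x. min (f x) (g x))"
    using that by (intro continuous_on_min SO_continuous)
  show "\<bar>min (f x) (g x) - min (f y) (g y)\<bar> \<le> 1 * (\<bar>f x - f y\<bar> + \<bar>g x - g y\<bar>)" for x y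
    by (smt (verit))
qed

lemma SO_abs: "(\<lambda>x::'a. \<bar>f x\<bar>) \<in> SO" if "f \<in> SO"
proof -
  have "(\<lambda>x. \<bar>f x\<bar>) = (\<lambda>x. max (f x) (-1 * f x))" by (auto simp: max_def abs_if fun_eq_iff)
  then show ?thesis using SO_max[OF that SO_scale[OF that, of "-1"]] by simp
qed

lemma SO_diff: "f \<in> SO \<Longrightarrow> g \<in> SO \<Longrightarrow> (\<lambda>x::'a. f x - g x) \<in> SO"
  using SO_add[OF _ SO_scale[of g "-1"], of f] by simp

lemma SO_sum:
  "(\<And>i. i \<in> I \<Longrightarrow> f i \<in> SO) \<Longrightarrow> (\<lambda>x::'a. \<Sum>i\<in>I. f i x) \<in> SO"
  by (induction I rule: infinite_finite_induct) (auto intro: SO_const SO_add)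

lemma SO_uniform_limit:
  fixes F :: "nat \<Rightarrow> 'a \<Rightarrow> real"
  assumes F: "\<And>n. F n \<in> SO" and lim: "uniform_limit UNIV F f sequentially"
  shows "f \<in> SO"
proof (rule SO_I[OF P])
  show "continuous_on UNIV f"
    by (rule uniform_limit_theorem[OF _ lim]) (auto intro!: always_eventually SO_continuous F)
  fix R e :: real assume Re: "R > 0" "e > 0"
  then obtain n where n: "\<And>x. dist (F n x) (f x) < e / 3"
    using uniform_limitD[OF lim, of "e/3"] by (auto simp: eventually_sequentially)
  obtain K where K: "compact K" "\<And>x y. x \<notin> K \<Longrightarrow> dist x y \<le> R \<Longrightarrow> \<bar>F n x - F n y\<bar> < e/3"
    using SO_oscE[OF P F[of n], of R "e/3"] Re by auto
  have "\<bar>f x - f y\<bar> < e" if "x \<notin> K" "dist x y \<le> R" for x y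
    using K(2)[OF that] n[of x] n[of y] unfolding dist_real_def by argo
  then show "\<exists>K. compact K \<and> (\<forall>x y. x \<notin> K \<longrightarrow> dist x y \<le> R \<longrightarrow> \<bar>f x - f y\<bar> < e)"
    using K(1) by blast
qed

lemma SO_compact_support:
  fixes f :: "'a \<Rightarrow> real"
  assumes c: "continuous_on UNIV f" and z: "\<And>x. x \<notin> cball p M \<Longrightarrow> f x = 0"
  shows "f \<in> SO"
proof (rule SO_I[OF P c])
  fix R e :: real assume Re: "R > 0" "e > 0"
  have "\<bar>f x - f y\<bar> < e" if "x \<notin> cball p (M + R)" "dist x y \<le> R" for x y
  proof -
    have "x \<notin> cball p M" "y \<notin> cball p M"
      using that Re dist_triangle[of p x y] by (auto simp: dist_commute)
    then show ?thesis using z Re by simp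
  qed
  then show "\<exists>K. compact K \<and> (\<forall>x y. x \<notin> K \<longrightarrow> dist x y \<le> R \<longrightarrow> \<bar>f x - f y\<bar> < e)"
    using compact_cball_proper[OF P] by blast
qed

text \<open>The derivative \<open>1 / (1 + t)\<close> of \<open>ln (1 + t)\<close> tends to 0. This function serves twice: it tends to
  infinity, and it vanishes only at \<open>p\<close>, so that \<^const>\<open>SO\<close> separates points.\<close>

lemma SO_ln_dist: "(\<lambda>x::'a. ln (1 + dist p x)) \<in> SO"
proof (rule SO_I[OF P])
  have pos: "0 < 1 + dist p x" for x by (smt (verit) zero_le_dist)
  show "continuous_on UNIV (\<lambda>x. ln (1 + dist p x))"
    by (intro continuous_intros) (use pos in \<open>metis less_irrefl\<close>)
  fix R e :: real assume Re: "R > 0" "e > 0"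
  have *: "ln (1 + dist p x) - ln (1 + dist p y) < e"
    if "dist p y > R / e" "dist x y \<le> R" for x y
  proof -
    have "ln (1 + dist p x) - ln (1 + dist p y) \<le> ((1 + dist p x) - (1 + dist p y)) / (1 + dist p y)"
      by (intro ln_diff_le pos)
    also have "\<dots> \<le> R / (1 + dist p y)"
      using pos[of y] that dist_triangle[of p x y]
      by (intro divide_right_mono) (auto simp: dist_commute)
    also have "\<dots> < e"
    proof -
      have "R < e * dist p y" using that Re by (simp add: field_simps)
      then show ?thesis using Re pos[of y] by (simp add: field_simps)
    qed
    finally show ?thesis .
  qed
  have "\<bar>ln (1 + dist p x) - ln (1 + dist p y)\<bar> < e"
    if "x \<notin> cball p (R / e + R)" "dist x y \<le> R" for x y
  proof -
    have "dist p x > R / e" "dist p y > R / e"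
      using that Re dist_triangle[of p x y] by (auto simp: dist_commute)
    then show ?thesis using *[of y x] *[of x y] that by (auto simp: dist_commute)
  qed
  then show "\<exists>K. compact K \<and> (\<forall>x y. x \<notin> K \<longrightarrow> dist x y \<le> R \<longrightarrow>
      \<bar>ln (1 + dist p x) - ln (1 + dist p y)\<bar> < e)"
    using compact_cball_proper[OF P] by blast
qed

end

section \<open>Superlinear majorants\<close>

lemma suminf_hinge_Lipschitz:
  fixes a :: "nat \<Rightarrow> real" and m :: nat
  assumes "\<And>n. n \<ge> m \<Longrightarrow> s \<le> a n" "\<And>n. n \<ge> m \<Longrightarrow> t \<le> a n"
  shows "\<bar>(\<Sum>n. max 0 (s - a n)) - (\<Sum>n. max 0 (t - a n))\<bar> \<le> real m * \<bar>s - t\<bar>"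
proof -
  have "(\<Sum>n. max 0 (s - a n)) = (\<Sum>n<m. max 0 (s - a n))"
       "(\<Sum>n. max 0 (t - a n)) = (\<Sum>n<m. max 0 (t - a n))"
    by (rule suminf_finite; use assms in \<open>simp add: not_less\<close>)+
  then have "\<bar>(\<Sum>n. max 0 (s - a n)) - (\<Sum>n. max 0 (t - a n))\<bar>
      = \<bar>\<Sum>n<m. max 0 (s - a n) - max 0 (t - a n)\<bar>"
    by (simp add: sum_subtractf)
  also have "\<dots> \<le> (\<Sum>n<m. \<bar>s - t\<bar>)"
    by (rule order_trans[OF sum_abs], rule sum_mono) auto
  finally show ?thesis by simp
qed

text \<open>The majorant is \<open>H \<circ> f\<close>, where \<open>H t\<close> is the sum of the hinges \<open>max 0 (t - a n)\<close>. If \<open>n\<close>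
  is the last index with \<open>a n < t\<close>, then \<open>H\<close> has slope at most \<open>n + 1\<close> up to \<open>t\<close>. The level \<open>a n\<close>
  is chosen so large that at points where \<open>f\<close> exceeds it, the oscillation of \<open>f\<close> at scale
  \<open>n + 1\<close> is already below \<open>1 / (n + 1)\<^sup>2\<close>. Since \<open>a n \<ge> n\<close>, only finitely many hinges are active
  at each \<open>t\<close>.\<close>

lemma SO_superlinear_majorant:
  fixes f :: "'a::metric_space \<Rightarrow> real"
  assumes P: "proper_space TYPE('a)" and f: "f \<in> SO"
  obtains g where "g \<in> SO" "\<And>N::nat. \<exists>c. \<forall>x. real N * f x - c \<le> g x"
proof -
  have "\<exists>K. compact K \<and> (\<forall>x y. x \<notin> K \<longrightarrow> dist x y \<le> real (Suc n) \<longrightarrow>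
      \<bar>f x - f y\<bar> < 1 / (real (Suc n))\<^sup>2)" for n
    using SO_oscE[OF P f, of "real (Suc n)" "1 / (real (Suc n))\<^sup>2"]
    by (metis of_nat_0_less_iff zero_less_Suc zero_less_divide_1_iff zero_less_power)
  then obtain K where K: "\<And>n. compact (K n)"
    and osc: "\<And>n x y. x \<notin> K n \<Longrightarrow> dist x y \<le> real (Suc n) \<Longrightarrow>
      \<bar>f x - f y\<bar> < 1 / (real (Suc n))\<^sup>2"
    by metis
  have "\<exists>a. a \<ge> real n \<and> (\<forall>x\<in>K n. f x \<le> a)" for n
  proof -
    have "bounded (f ` K n)"
      using K SO_continuous[OF f]
      by (intro compact_imp_bounded compact_continuous_image) (auto intro: continuous_on_subset)
    then obtain B where "\<forall>x\<in>K n. \<bar>f x\<bar> \<le> B" by (auto simp: bounded_iff)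
    then show ?thesis by (intro exI[of _ "max B (real n)"]) force
  qed
  then obtain a where a_ge: "\<And>n. a n \<ge> real n" and a_K: "\<And>n x. x \<in> K n \<Longrightarrow> f x \<le> a n"
    by metis
  define H where "H t = (\<Sum>n. max 0 (t - a n))" for t
  define g where "g x = H (f x)" for x
  have fin: "\<exists>m. \<forall>n\<ge>m. t \<le> a n" for t
    using a_ge by (metis le_nat_iff nat_ceiling_le_eq of_nat_le_iff order_trans real_nat_ceiling_ge)
  have H_lip: "\<bar>H s - H t\<bar> \<le> real m * \<bar>s - t\<bar>" if "\<forall>n\<ge>m. s \<le> a n" "\<forall>n\<ge>m. t \<le> a n" for m s t
    unfolding H_def using that by (intro suminf_hinge_Lipschitz) auto
  have summ: "summable (\<lambda>n. max 0 (t - a n))" for t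
  proof -
    obtain m where m: "\<forall>n\<ge>m. t \<le> a n" using fin by blast
    show ?thesis by (rule summable_finite[of "{..<m}"]) (use m in \<open>simp_all add: not_less\<close>)
  qed
  have H_cont: "continuous_on UNIV H"
  proof -
    have "continuous_on {..<M} H" for M
    proof -
      obtain m where m: "\<forall>n\<ge>m. M \<le> a n" using fin by blast
      have "(real m)-lipschitz_on {..<M} H"
        using m by (intro lipschitz_onI) (auto simp: dist_real_def intro!: H_lip intro: order.strict_implies_order order_trans)
      then show ?thesis by (rule lipschitz_on_continuous_on)
    qed
    then have "continuous_on (\<Union>M\<in>UNIV. {..<M}) H"
      by (intro continuous_on_open_UN) auto
    moreover have "(\<Union>M\<in>UNIV. {..<M}) = (UNIV :: real set)" by (auto intro: gt_ex)
    ultimately show ?thesis by simp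
  qed
  have "g \<in> SO"
  proof (rule SO_I[OF P])
    show "continuous_on UNIV g" unfolding g_def
      using continuous_on_compose2[OF H_cont SO_continuous[OF f]] by simp
    fix R e :: real assume Re: "R > 0" "e > 0"
    obtain n0 where n0: "real n0 \<ge> R" "1 / real (Suc n0) < e"
    proof -
      obtain i where i: "1 / real (Suc i) < e" using nat_approx_posE[OF Re(2)] by auto
      define j where "j = max i (nat \<lceil>R\<rceil>)"
      have "1 / real (Suc j) \<le> 1 / real (Suc i)" by (intro frac_le) (auto simp: j_def)
      moreover have "real j \<ge> R" unfolding j_def by linarith
      ultimately show thesis using that i by force
    qed
    obtain L where L: "compact L"
      "\<And>x y. x \<notin> L \<Longrightarrow> dist x y \<le> R \<Longrightarrow> \<bar>f x - f y\<bar> < e / real (Suc n0)"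
      using SO_oscE[OF P f Re(1), of "e / real (Suc n0)"] Re by auto
    \<comment> \<open>The slope of \<open>H\<close> on the interval from \<open>f y\<close> to \<open>f x\<close> is governed by the larger value. If
        it is steep, then \<open>f x\<close> is large and the oscillation of \<open>f\<close> at \<open>x\<close> is tiny; otherwise the
        bound on \<open>\<bar>f x - f y\<bar>\<close> suffices.\<close>
    have main: "\<bar>g x - g y\<bar> < e"
      if xy: "dist x y \<le> R" "\<bar>f x - f y\<bar> < e / real (Suc n0)" and le: "f y \<le> f x" for x y
    proof -
      define m where "m = (LEAST m. \<forall>n\<ge>m. f x \<le> a n)"
      have m: "\<forall>n\<ge>m. f x \<le> a n" unfolding m_def by (rule LeastI_ex[OF fin])
      have lip: "\<bar>g x - g y\<bar> \<le> real m * \<bar>f x - f y\<bar>"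
        unfolding g_def using m le by (intro H_lip) force+
      show ?thesis
      proof (cases "m \<le> Suc n0")
        case True
        have "\<bar>g x - g y\<bar> \<le> real (Suc n0) * \<bar>f x - f y\<bar>"
          using True by (intro order_trans[OF lip] mult_right_mono) auto
        also have "\<dots> < real (Suc n0) * (e / real (Suc n0))"
          using xy by (intro mult_strict_left_mono) auto
        finally show ?thesis by simp
      next
        case False
        then obtain k where k: "m = Suc k" "k \<ge> n0" by (cases m) auto
        have "\<not> (\<forall>n\<ge>k. f x \<le> a n)"
          using k not_less_Least[of k "\<lambda>m. \<forall>n\<ge>m. f x \<le> a n"] by (simp add: m_def)
        then have "f x > a k" using m k by (metis le_eq_less_or_eq not_le Suc_leI)
        then have "x \<notin> K k" using a_K by force
        moreover have "dist x y \<le> real (Suc k)" using xy n0 k by simp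
        ultimately have o: "\<bar>f x - f y\<bar> < 1 / (real (Suc k))\<^sup>2" by (rule osc)
        have "\<bar>g x - g y\<bar> \<le> real (Suc k) * \<bar>f x - f y\<bar>" using lip k by simp
        also have "\<dots> \<le> real (Suc k) * (1 / (real (Suc k))\<^sup>2)"
          using o by (intro mult_left_mono) auto
        also have "\<dots> = 1 / real (Suc k)" by (simp add: power2_eq_square)
        also have "\<dots> \<le> 1 / real (Suc n0)" using k by (intro frac_le) auto
        also have "\<dots> < e" by (rule n0)
        finally show ?thesis .
      qed
    qed
    have "\<bar>g x - g y\<bar> < e" if "x \<notin> L" "dist x y \<le> R" for x y
      using main[of x y] main[of y x] L(2)[OF that] that
      by (cases "f y \<le> f x") (auto simp: dist_commute abs_minus_commute)
    then show "\<exists>K. compact K \<and> (\<forall>x y. x \<notin> K \<longrightarrow> dist x y \<le> R \<longrightarrow> \<bar>g x - g y\<bar> < e)"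
      using L(1) by blast
  qed
  moreover have "\<exists>c. \<forall>x. real N * f x - c \<le> g x" for N
  proof (intro exI allI)
    fix x
    have "real N * f x - (\<Sum>n<N. a n) = (\<Sum>n<N. f x - a n)" by (simp add: sum_subtractf)
    also have "\<dots> \<le> (\<Sum>n<N. max 0 (f x - a n))" by (rule sum_mono) simp
    also have "\<dots> \<le> g x" unfolding g_def H_def by (rule sum_le_suminf[OF summ]) auto
    finally show "real N * f x - (\<Sum>n<N. a n) \<le> g x" .
  qed
  ultimately show thesis by (rule that)
qed

section \<open>Real lattice homomorphisms are weighted point evaluations\<close>

definition lattice_functional :: "('a \<Rightarrow> real) set \<Rightarrow> (('a \<Rightarrow> real) \<Rightarrow> real) \<Rightarrow> bool" where
  "lattice_functional A \<phi> \<longleftrightarrow>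
     (\<forall>f\<in>A. \<forall>g\<in>A. \<phi> (\<lambda>x. f x + g x) = \<phi> f + \<phi> g) \<and>
     (\<forall>c. \<forall>f\<in>A. \<phi> (\<lambda>x. c * f x) = c * \<phi> f) \<and>
     (\<forall>f\<in>A. \<forall>g\<in>A. \<phi> (\<lambda>x. max (f x) (g x)) = max (\<phi> f) (\<phi> g))"

context
  fixes \<phi> :: "('a::metric_space \<Rightarrow> real) \<Rightarrow> real"
  assumes P: "proper_space TYPE('a)" and lf: "lattice_functional SO \<phi>"
begin

lemma functional_add: "f \<in> SO \<Longrightarrow> g \<in> SO \<Longrightarrow> \<phi> (\<lambda>x. f x + g x) = \<phi> f + \<phi> g"
  and functional_scale: "f \<in> SO \<Longrightarrow> \<phi> (\<lambda>x. c * f x) = c * \<phi> f"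
  and functional_max: "f \<in> SO \<Longrightarrow> g \<in> SO \<Longrightarrow> \<phi> (\<lambda>x. max (f x) (g x)) = max (\<phi> f) (\<phi> g)"
  using lf unfolding lattice_functional_def by blast+

lemma functional_const: "\<phi> (\<lambda>x. c) = c * \<phi> (\<lambda>x. 1)"
  using functional_scale[OF SO_const[OF P], of c 1] by simp

lemma functional_affine: "f \<in> SO \<Longrightarrow> \<phi> (\<lambda>x. c * f x - d) = c * \<phi> f - d * \<phi> (\<lambda>x. 1)"
  using functional_add[OF SO_scale[OF P, of f c] SO_const[OF P, of "-d"]]
  by (simp add: functional_scale functional_const[of "-d"])

lemma functional_mono:
  assumes "f \<in> SO" "g \<in> SO" "\<And>x. f x \<le> g x"
  shows "\<phi> f \<le> \<phi> g"
proof -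
  have "(\<lambda>x. max (f x) (g x)) = g" using assms(3) by (auto simp: max_def)
  then show ?thesis using functional_max[OF assms(1,2)] by simp
qed

lemma functional_abs:
  assumes "f \<in> SO"
  shows "\<phi> (\<lambda>x. \<bar>f x\<bar>) = \<bar>\<phi> f\<bar>"
proof -
  have "(\<lambda>x. \<bar>f x\<bar>) = (\<lambda>x. max (f x) (-1 * f x))" by (auto simp: max_def abs_if fun_eq_iff)
  then show ?thesis
    using functional_max[OF assms SO_scale[OF P assms, of "-1"]] functional_scale[OF assms, of "-1"]
    by (simp add: max_def abs_if)
qed

lemma functional_sum_zero:
  assumes "finite I" "\<And>i. i \<in> I \<Longrightarrow> g i \<in> SO" "\<And>i. i \<in> I \<Longrightarrow> \<phi> (g i) = 0"
  shows "\<phi> (\<lambda>x. \<Sum>i\<in>I. g i x) = 0"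
  using assms
proof (induction I rule: finite_induct)
  case empty
  then show ?case using functional_const[of 0] by simp
next
  case (insert i I)
  then show ?case using functional_add[of "g i" "\<lambda>x. \<Sum>i\<in>I. g i x"] SO_sum[OF P, of I g] by simp
qed

text \<open>If \<open>\<phi>\<close> vanishes on constants, then it cannot see the constants \<open>c\<close> in
  \<open>N * \<bar>f\<bar> - c \<le> g\<close>, and \<open>\<phi> g\<close> would have to exceed every multiple of \<open>\<phi> \<bar>f\<bar>\<close>.\<close>

lemma functional_one_pos:
  assumes "f \<in> SO" "\<phi> f \<noteq> 0"
  shows "\<phi> (\<lambda>x. 1) > 0"
proof (rule ccontr)
  assume "\<not> \<phi> (\<lambda>x. 1) > 0"
  moreover have "\<phi> (\<lambda>x. 0) \<le> \<phi> (\<lambda>x. 1)" by (intro functional_mono SO_const[OF P]) auto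
  ultimately have one: "\<phi> (\<lambda>x. 1) = 0" using functional_const[of 0] by simp
  define h where "h = (\<lambda>x. \<bar>f x\<bar>)"
  have h: "h \<in> SO" "\<phi> h > 0"
    unfolding h_def using assms by (auto simp: SO_abs[OF P] functional_abs)
  obtain g where g: "g \<in> SO" "\<And>N::nat. \<exists>c. \<forall>x. real N * h x - c \<le> g x"
    using SO_superlinear_majorant[OF P h(1)] by blast
  have "real N * \<phi> h \<le> \<phi> g" for N
  proof -
    obtain c where c: "\<forall>x. real N * h x - c \<le> g x" using g by blast
    have "\<phi> (\<lambda>x. real N * h x - c) \<le> \<phi> g"
      using c by (intro functional_mono g(1) SO_diff[OF P] SO_scale[OF P] SO_const[OF P] h(1)) auto
    then show ?thesis using functional_affine[OF h(1)] one by simp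
  qed
  moreover obtain N :: nat where "real N * \<phi> h > \<phi> g" using h(2) reals_Archimedean3 by blast
  ultimately show False by (meson not_le)
qed

text \<open>Suppose that for each \<open>y\<close> some function is not evaluated correctly at \<open>y\<close>. This gives
  nonnegative functions \<open>g y\<close> in the kernel of \<open>\<phi>\<close> with \<open>g y y > 0\<close>. Truncating
  \<open>ln (1 + dist p x)\<close> from below gives a further nonnegative function \<open>k\<close> in the kernel that is at
  least 1 off a compact ball. The sum of \<open>k\<close> and finitely many \<open>g y\<close> is bounded below by a
  positive constant, yet \<open>\<phi>\<close> annihilates it.\<close>

lemma functional_point_evaluation:
  assumes nz: "f0 \<in> SO" "\<phi> f0 \<noteq> 0"
  shows "\<exists>y. \<forall>f\<in>SO. \<phi> f = \<phi> (\<lambda>x. 1) * f y"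
proof (rule ccontr)
  assume "\<nexists>y. \<forall>f\<in>SO. \<phi> f = \<phi> (\<lambda>x. 1) * f y"
  then obtain h where h: "\<And>y. h y \<in> SO" "\<And>y. \<phi> (h y) \<noteq> \<phi> (\<lambda>x. 1) * h y y" by metis
  define p where "p = \<phi> (\<lambda>x. 1)"
  have p: "p > 0" unfolding p_def by (rule functional_one_pos[OF nz])
  define g where "g y = (\<lambda>x. \<bar>p * h y x - \<phi> (h y)\<bar>)" for y
  have aff: "(\<lambda>x. p * f x - c) \<in> SO" if "f \<in> SO" for f :: "'a \<Rightarrow> real" and c
    by (intro SO_diff[OF P] SO_scale[OF P] SO_const[OF P] that)
  have g_SO: "g y \<in> SO" for y unfolding g_def by (intro SO_abs[OF P] aff h)
  have g0: "\<phi> (g y) = 0" for y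
    unfolding g_def using functional_abs[OF aff[OF h(1)]] functional_affine[OF h(1)]
    by (simp add: p_def)
  have g_pos: "g y y > 0" for y unfolding g_def p_def using h(2)[of y] by simp
  have g_nn: "g y x \<ge> 0" for x y by (simp add: g_def)
  obtain p0 :: 'a where True by simp
  define l where "l = (\<lambda>x. ln (1 + dist p0 x))"
  have l: "l \<in> SO" unfolding l_def by (rule SO_ln_dist[OF P])
  define k where "k = (\<lambda>x. max 0 (p * l x - \<phi> l))"
  have k: "k \<in> SO" unfolding k_def by (intro SO_max[OF P] SO_const[OF P] aff l)
  have k0: "\<phi> k = 0"
    unfolding k_def using functional_max[OF SO_const[OF P, of 0] aff[OF l]]
      functional_affine[OF l] functional_const[of 0] by (simp add: p_def)
  \<comment> \<open>The radius beyond which \<open>p * l x - \<phi> l \<ge> 1\<close>.\<close>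
  define M where "M = exp ((\<phi> l + 1) / p)"
  have k1: "k x \<ge> 1" if "x \<notin> cball p0 M" for x
  proof -
    have "M \<le> 1 + dist p0 x" using that by simp
    then have "ln M \<le> l x" unfolding l_def by (subst ln_le_cancel_iff) (auto simp: M_def add_pos_nonneg)
    then have "(\<phi> l + 1) / p \<le> l x" by (simp add: M_def)
    then show ?thesis using p by (simp add: k_def field_simps)
  qed
  have cp: "compact (cball p0 M)" by (rule compact_cball_proper[OF P])
  have op: "open {x. g y x > 0}" for y
    using SO_continuous[OF g_SO[of y]] by (intro open_Collect_less) auto
  obtain D where D: "finite D" "cball p0 M \<subseteq> (\<Union>y\<in>D. {x. g y x > 0})"
    by (rule compactE_image[OF cp, of "cball p0 M" "\<lambda>y. {x. g y x > 0}"])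
      (use op g_pos in auto)
  define G where "G = (\<lambda>x. k x + (\<Sum>y\<in>D. g y x))"
  have sm: "(\<lambda>x. \<Sum>y\<in>D. g y x) \<in> SO" by (intro SO_sum[OF P] g_SO)
  have G: "G \<in> SO" unfolding G_def by (intro SO_add[OF P] k sm)
  have G0: "\<phi> G = 0"
    unfolding G_def using functional_add[OF k sm] k0 functional_sum_zero[OF D(1) g_SO g0] by simp
  have s_nn: "(\<Sum>y\<in>D. g y x) \<ge> 0" for x by (intro sum_nonneg g_nn)
  have "p0 \<in> cball p0 M" by (simp add: M_def)
  then obtain z where z: "z \<in> cball p0 M" "\<And>x. x \<in> cball p0 M \<Longrightarrow> G z \<le> G x"
    using continuous_attains_inf[OF cp, of G] SO_continuous[OF G] continuous_on_subset by blast
  have "G z > 0"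
  proof -
    obtain y where y: "y \<in> D" "g y z > 0" using D z by blast
    have "(\<Sum>y\<in>D. g y z) > 0" by (rule sum_pos2[where i = y]) (use D(1) y g_nn in auto)
    then show ?thesis by (simp add: G_def k_def)
  qed
  define d where "d = min 1 (G z)"
  have d: "d > 0" using \<open>G z > 0\<close> by (simp add: d_def)
  have "d \<le> G x" for x
  proof (cases "x \<in> cball p0 M")
    case True then show ?thesis using z(2) by (simp add: d_def min.coboundedI2)
  next
    case False then show ?thesis using k1[OF False] s_nn[of x] by (simp add: d_def G_def)
  qed
  then have "\<phi> (\<lambda>x. d) \<le> \<phi> G" by (intro functional_mono SO_const[OF P] G)
  then have "d * p \<le> 0" using G0 functional_const[of d] by (simp add: p_def)
  then show False using d p by (simp add: mult_le_0_iff)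
qed

end

section \<open>Isomorphisms are weighted composition operators\<close>

lemma SO_isosD:
  fixes T :: "('b::metric_space \<Rightarrow> real) \<Rightarrow> ('a::metric_space \<Rightarrow> real)"
  assumes "T \<in> SO_isos"
  shows "f \<in> SO \<Longrightarrow> T f \<in> SO" "bij_betw T SO SO" "T \<in> extensional SO"
    "f \<in> SO \<Longrightarrow> g \<in> SO \<Longrightarrow> T (\<lambda>y. f y + g y) = (\<lambda>x. T f x + T g x)"
    "f \<in> SO \<Longrightarrow> T (\<lambda>y. c * f y) = (\<lambda>x. c * T f x)"
    "f \<in> SO \<Longrightarrow> g \<in> SO \<Longrightarrow> T (\<lambda>y. max (f y) (g y)) = (\<lambda>x. max (T f x) (T g x))"
    "f \<in> SO \<Longrightarrow> g \<in> SO \<Longrightarrow> T (\<lambda>y. min (f y) (g y)) = (\<lambda>x. min (T f x) (T g x))"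
  using assms unfolding SO_isos_def lattice_isos_def by (auto simp: PiE_def)

lemma
  fixes T :: "('b::metric_space \<Rightarrow> real) \<Rightarrow> ('a::metric_space \<Rightarrow> real)"
  assumes PX: "proper_space TYPE('a)" and PY: "proper_space TYPE('b)" and T: "T \<in> SO_isos"
  shows SO_isos_one_pos: "T (\<lambda>_. 1) x > 0"
    and SO_isos_weighted_composition: "\<exists>\<tau>. \<forall>f\<in>SO. \<forall>x. T f x = T (\<lambda>_. 1) x * f (\<tau> x)"
proof -
  have lf: "lattice_functional SO (\<lambda>f. T f x)" for x
    unfolding lattice_functional_def
    using SO_isosD(4-6)[OF T, THEN fun_cong, of _ _ x] SO_isosD(5)[OF T, THEN fun_cong, of _ _ x] by blast
  obtain e where e: "e \<in> SO" "T e = (\<lambda>_. 1)"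
    using SO_isosD(2)[OF T] SO_const[OF PX, of 1] by (metis bij_betw_iff_bijections)
  have nz: "T e x \<noteq> 0" for x using e by simp
  show "T (\<lambda>_. 1) x > 0" by (rule functional_one_pos[OF PY lf e(1) nz])
  have "\<exists>y. \<forall>f\<in>SO. T f x = T (\<lambda>_. 1) x * f y" for x
    by (rule functional_point_evaluation[OF PY lf e(1) nz])
  then show "\<exists>\<tau>. \<forall>f\<in>SO. \<forall>x. T f x = T (\<lambda>_. 1) x * f (\<tau> x)" by metis
qed

lemma SO_isos_inverse:
  fixes T :: "('b::metric_space \<Rightarrow> real) \<Rightarrow> ('a::metric_space \<Rightarrow> real)"
  assumes PY: "proper_space TYPE('b)" and PX: "proper_space TYPE('a)" and T: "T \<in> SO_isos"
  shows "\<exists>S\<in>SO_isos. (\<forall>f\<in>SO. T (S f) = f) \<and> (\<forall>f\<in>SO. S (T f) = f)"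
proof -
  define S where "S = restrict (inv_into SO T) SO"
  note D = SO_isosD[OF T]
  have bS: "bij_betw S SO SO"
    using bij_betw_inv_into[OF D(2)] by (simp add: S_def cong: bij_betw_cong)
  have TS: "T (S g) = g" if "g \<in> SO" for g
    using that D(2) by (simp add: S_def bij_betw_inv_into_right)
  have ST: "S (T f) = f" if "f \<in> SO" for f
    using that D(1,2) by (simp add: S_def bij_betw_inv_into_left)
  have SS: "S g \<in> SO" if "g \<in> SO" for g using that bij_betwE[OF bS] by blast
  have "S \<in> SO_isos" unfolding SO_isos_def lattice_isos_def
  proof (intro CollectI conjI ballI allI)
    show "S \<in> SO \<rightarrow>\<^sub>E SO" using SS by (auto simp: S_def)
    show "bij_betw S SO SO" by (rule bS)
  next
    fix f g :: "'a \<Rightarrow> real" assume fg: "f \<in> SO" "g \<in> SO"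
    note s = SS[OF fg(1)] SS[OF fg(2)]
    show "S (\<lambda>y. f y + g y) = (\<lambda>x. S f x + S g x)"
      using ST[OF SO_add[OF PY s]] unfolding D(4)[OF s] TS[OF fg(1)] TS[OF fg(2)] .
    show "S (\<lambda>y. max (f y) (g y)) = (\<lambda>x. max (S f x) (S g x))"
      using ST[OF SO_max[OF PY s]] unfolding D(6)[OF s] TS[OF fg(1)] TS[OF fg(2)] .
    show "S (\<lambda>y. min (f y) (g y)) = (\<lambda>x. min (S f x) (S g x))"
      using ST[OF SO_min[OF PY s]] unfolding D(7)[OF s] TS[OF fg(1)] TS[OF fg(2)] .
  next
    fix c and f :: "'a \<Rightarrow> real" assume f: "f \<in> SO"
    show "S (\<lambda>y. c * f y) = (\<lambda>x. c * S f x)"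
      using ST[OF SO_scale[OF PY SS[OF f]], of c] unfolding D(5)[OF SS[OF f]] TS[OF f] .
  qed
  then show ?thesis using TS ST by (intro bexI conjI ballI)
qed

section \<open>The weight of an isomorphism is bounded\<close>

lemma chain_connected_neighbour:
  fixes x z :: "'a::metric_space"
  assumes "r_chain_connected TYPE('a) r" "z \<noteq> x"
  obtains x' where "x' \<noteq> x" "dist x x' \<le> r"
proof -
  have "\<exists>(n::nat) p. p 0 = x \<and> p n = z \<and> (\<forall>i\<in>{1..n}. dist (p (i - 1)) (p i) \<le> r)"
    using assms(1) unfolding r_chain_connected_def by (elim allE)
  then obtain n :: nat where "\<exists>p. p 0 = x \<and> p n = z \<and> (\<forall>i\<in>{1..n}. dist (p (i - 1)) (p i) \<le> r)"
    by (rule exE)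
  then obtain p where "p 0 = x \<and> p n = z \<and> (\<forall>i\<in>{1..n}. dist (p (i - 1)) (p i) \<le> r)"
    by (rule exE)
  then have p: "p 0 = x" "p n = z" "\<forall>i\<in>{1..n}. dist (p (i - 1)) (p i) \<le> r"
    by simp_all
  define i where "i = (LEAST i. p i \<noteq> x)"
  have i: "p i \<noteq> x" unfolding i_def by (rule LeastI[of _ n]) (use p assms in simp)
  have "i \<le> n" unfolding i_def by (rule Least_le) (use p assms in simp)
  have "i \<noteq> 0" using i p(1) by metis
  then have "p (i - 1) = x" using not_less_Least[of "i - 1" "\<lambda>i. p i \<noteq> x"] by (simp add: i_def)
  moreover have "dist (p (i - 1)) (p i) \<le> r" using p(3) \<open>i \<le> n\<close> \<open>i \<noteq> 0\<close> by auto
  ultimately show thesis using that[OF i] by simp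
qed

text \<open>The separation hypothesis keeps the \<open>n\<close>-th bump, of radius at most 1 around \<open>y n\<close>, away from
  all \<open>y' m\<close> with \<open>m \<noteq> n\<close>; capping the radius at \<open>dist (y n) (y' n)\<close> handles \<open>y' n\<close>.
  Summability of the heights makes the sum a uniform limit of compactly supported functions.\<close>

lemma SO_gliding_hump:
  fixes y y' :: "nat \<Rightarrow> 'b::metric_space" and c :: "nat \<Rightarrow> real"
  assumes P: "proper_space TYPE('b)" and c: "\<And>n. c n \<ge> 0" "summable c"
    and ne: "\<And>n. y n \<noteq> y' n"
    and sep: "\<And>m n. m \<noteq> n \<Longrightarrow> dist (y n) (y' m) \<ge> 1"
  obtains f where "f \<in> SO" "\<And>n. f (y n) \<ge> c n" "\<And>n. f (y' n) = 0"
proof -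
  define \<rho> where "\<rho> n = min 1 (dist (y n) (y' n))" for n
  define b where "b n u = max 0 (1 - dist (y n) u / \<rho> n)" for n u
  have \<rho>: "\<rho> n > 0" for n using ne[of n] by (simp add: \<rho>_def)
  have b_nn: "b n u \<ge> 0" and b_le: "b n u \<le> 1" for n u
    using \<rho>[of n] by (auto simp: b_def)
  have b_SO: "b n \<in> SO" for n
  proof (rule SO_compact_support[OF P])
    show "continuous_on UNIV (b n)" unfolding b_def using \<rho>[of n] by (intro continuous_intros) auto
    show "b n u = 0" if "u \<notin> cball (y n) (\<rho> n)" for u
      using that \<rho>[of n] by (simp add: b_def field_simps)
  qed
  have b0: "b n (y' m) = 0" for n m
  proof -
    have "\<rho> n \<le> dist (y n) (y' m)"
      using sep[of m n] by (cases "m = n") (auto simp: \<rho>_def)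
    then show ?thesis using \<rho>[of n] by (simp add: b_def field_simps)
  qed
  define f where "f u = (\<Sum>n. c n * b n u)" for u
  have summ: "summable (\<lambda>n. c n * b n u)" for u
    by (rule summable_comparison_test'[OF c(2), of 0])
      (use c(1) b_nn b_le in \<open>simp add: abs_mult mult_left_le\<close>)
  have lim: "uniform_limit UNIV (\<lambda>N u. \<Sum>n<N. c n * b n u) f sequentially"
    unfolding f_def using c b_nn b_le
    by (intro Weierstrass_m_test[where M = c]) (auto simp: abs_mult mult_left_le)
  have "f \<in> SO"
    by (rule SO_uniform_limit[OF P _ lim]) (intro SO_sum[OF P] SO_scale[OF P] b_SO)
  moreover have "f (y n) \<ge> c n" for n
  proof -
    have "c n = c n * b n (y n)" by (simp add: b_def)
    also have "\<dots> = (\<Sum>k\<in>{n}. c k * b k (y n))" by simp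
    also have "\<dots> \<le> f (y n)" unfolding f_def
      by (rule sum_le_suminf[OF summ]) (use c(1) b_nn in auto)
    finally show ?thesis .
  qed
  moreover have "f (y' n) = 0" for n by (simp add: f_def b0)
  ultimately show thesis by (rule that)
qed

text \<open>The humps are placed along points \<open>\<tau> (x n)\<close>, and these must leave every compact set.
  This follows from \<open>w x * v (\<tau> x) = 1\<close>, where \<open>v\<close> is the weight of the inverse: \<open>v\<close> is continuous and positive, hence
  bounded away from 0 on compact sets, so \<open>\<tau> x\<close> is far out as soon as \<open>w x\<close> is large. The same
  holds for a neighbour \<open>x'\<close> of \<open>x\<close>, because \<open>w\<close> itself is slowly oscillating.\<close>

lemma SO_isos_weight_bounded:
  fixes T :: "('b::metric_space \<Rightarrow> real) \<Rightarrow> ('a::metric_space \<Rightarrow> real)"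
  assumes PX: "proper_space TYPE('a)" and CX: "chain_connected TYPE('a)"
    and PY: "proper_space TYPE('b)" and T: "T \<in> SO_isos"
  shows "bounded (range (T (\<lambda>_. 1)))"
proof (rule ccontr)
  assume unb: "\<not> bounded (range (T (\<lambda>_. 1)))"
  define w where "w = T (\<lambda>_. 1)"
  have w_pos: "w x > 0" for x unfolding w_def by (rule SO_isos_one_pos[OF PX PY T])
  obtain \<tau> where \<tau>: "\<forall>f\<in>SO. \<forall>x. T f x = w x * f (\<tau> x)"
    using SO_isos_weighted_composition[OF PX PY T] unfolding w_def by (rule exE)
  note T_eq = \<tau>[rule_format]
  obtain S where S: "S \<in> SO_isos" and inv: "(\<forall>f\<in>SO. T (S f) = f) \<and> (\<forall>f\<in>SO. S (T f) = f)"
    using SO_isos_inverse[OF PY PX T] by (rule bexE)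
  note TS = inv[THEN conjunct1, rule_format]
  define v where "v = S (\<lambda>_. 1)"
  have w_SO: "w \<in> SO" unfolding w_def by (rule SO_isosD(1)[OF T SO_const[OF PY]])
  have v_SO: "v \<in> SO" unfolding v_def by (rule SO_isosD(1)[OF S SO_const[OF PX]])
  have v_pos: "v y > 0" for y
    unfolding v_def by (rule SO_isos_one_pos[OF PY PX S])
  have wv: "w x * v (\<tau> x) = 1" for x
    using T_eq[OF v_SO, of x] TS[OF SO_const[OF PX, of 1]] by (simp add: v_def)
  \<comment> \<open>\<open>T\<close> is surjective and \<^const>\<open>SO\<close> separates points.\<close>
  have \<tau>_inj: "x = x'" if eq: "\<tau> x = \<tau> x'" for x x'
  proof -
    have "w x = w x'" using wv[of x] wv[of x'] v_pos[of "\<tau> x'"] unfolding eq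
      by (metis mult_right_cancel less_irrefl)
    then have "g x = g x'" if "g \<in> SO" for g
      using T_eq[OF SO_isosD(1)[OF S that], of x] T_eq[OF SO_isosD(1)[OF S that], of x']
      unfolding TS[OF that] eq by simp
    from this[OF SO_ln_dist[OF PX, of x]] show ?thesis by (simp add: ln_eq_zero_iff add_pos_nonneg)
  qed
  have large: "\<exists>x. w x > B" for B
  proof (rule ccontr)
    assume "\<nexists>x. w x > B"
    then have "\<bar>w x\<bar> \<le> B" for x using w_pos[of x] by (simp add: not_less)
    then have "bounded (range w)" by (auto simp: bounded_iff)
    then show False using unb by (simp add: w_def)
  qed
  obtain r where r: "r > 0" "r_chain_connected TYPE('a) r"
    using CX unfolding chain_connected_def by blast
  obtain p0 :: 'b where True by simp
  have far: "\<exists>B. \<forall>x. w x > B \<longrightarrow> dist p0 (\<tau> x) > N" for N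
  proof -
    define C where "C = cball p0 (max 0 N)"
    have "p0 \<in> C" by (simp add: C_def)
    have cp: "compact C" unfolding C_def by (rule compact_cball_proper[OF PY])
    obtain z where z: "z \<in> C" "\<forall>y\<in>C. v z \<le> v y"
      using continuous_attains_inf[OF cp, of v] \<open>p0 \<in> C\<close> SO_continuous[OF v_SO] continuous_on_subset by blast
    have "dist p0 (\<tau> x) > N" if "w x > 1 / v z" for x
    proof (rule ccontr)
      assume "\<not> dist p0 (\<tau> x) > N"
      then have "v z \<le> v (\<tau> x)" using z by (simp add: C_def)
      then have "w x * v z \<le> 1" using wv[of x] w_pos[of x] by (metis mult_left_mono less_imp_le)
      then show False using that v_pos[of z] by (simp add: field_simps)
    qed
    then show ?thesis by blast
  qed
  have pairs: "\<exists>x x'. x \<noteq> x' \<and> dist x x' \<le> r \<and> w x \<ge> N \<and> dist p0 (\<tau> x) \<ge> N \<and> dist p0 (\<tau> x') \<ge> N" for N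
  proof -
    obtain B where B: "\<forall>x. w x > B \<longrightarrow> dist p0 (\<tau> x) > N" using far by blast
    obtain K where K: "compact K" "\<And>x y. x \<notin> K \<Longrightarrow> dist x y \<le> r \<Longrightarrow> \<bar>w x - w y\<bar> < 1"
      using SO_oscE[OF PX w_SO r(1), of 1] by auto
    have "bounded (w ` K)"
      using K(1) SO_continuous[OF w_SO]
      by (intro compact_imp_bounded compact_continuous_image) (auto intro: continuous_on_subset)
    then obtain A where A: "\<forall>x\<in>K. \<bar>w x\<bar> \<le> A" by (auto simp: bounded_iff)
    obtain x where x: "w x > max (max A N) (B + 1)" using large by blast
    obtain z where z: "w z > w x" using large by blast
    then have "z \<noteq> x" by auto
    then obtain x' where x': "x' \<noteq> x" "dist x x' \<le> r" using chain_connected_neighbour[OF r(2)] by blast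
    have "x \<notin> K" using A x by force
    then have "\<bar>w x - w x'\<bar> < 1" using K(2) x' by blast
    then have "w x > B" "w x' > B" "w x \<ge> N" using x by linarith+
    then have "dist p0 (\<tau> x) \<ge> N" "dist p0 (\<tau> x') \<ge> N" "w x \<ge> N"
      using B by (auto intro: less_imp_le)
    then show ?thesis using x' by metis
  qed
  \<comment> \<open>Successive pairs are chosen with images in annuli at distance at least 1 from each other.
      Growth of the weight like \<open>2 ^ n\<close> makes the bump heights \<open>1 / w (x n)\<close> summable.\<close>
  define Q where "Q = (\<lambda>(n::nat) (q::'a \<times> 'a). fst q \<noteq> snd q \<and> dist (fst q) (snd q) \<le> r \<and> w (fst q) \<ge> 2 ^ n
      \<and> dist p0 (\<tau> (fst q)) \<ge> real n \<and> dist p0 (\<tau> (snd q)) \<ge> real n)"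
  define gap where "gap = (\<lambda>q q'. \<forall>i\<in>{fst q, snd q}. \<forall>j\<in>{fst q', snd q'}. dist p0 (\<tau> i) + 1 \<le> dist p0 (\<tau> j))"
  have "\<exists>q. \<forall>n. Q n (q n) \<and> gap (q n) (q (Suc n))"
  proof (rule dependent_nat_choice)
    show "\<exists>q. Q 0 q" using pairs[of 1] unfolding Q_def by auto
    fix q n
    show "\<exists>q'. Q (Suc n) q' \<and> gap q q'"
    proof -
      define N where "N = max (2 ^ Suc n) (max (real (Suc n)) (max (dist p0 (\<tau> (fst q))) (dist p0 (\<tau> (snd q))) + 1))"
      have N: "2 ^ Suc n \<le> N" "real (Suc n) \<le> N" "dist p0 (\<tau> (fst q)) + 1 \<le> N" "dist p0 (\<tau> (snd q)) + 1 \<le> N"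
        unfolding N_def by auto
      obtain x x' where x: "x \<noteq> x'" "dist x x' \<le> r" "w x \<ge> N" "dist p0 (\<tau> x) \<ge> N" "dist p0 (\<tau> x') \<ge> N"
        using pairs[of N] by blast
      have "Q (Suc n) (x, x') \<and> gap q (x, x')"
        unfolding Q_def gap_def using x N by fastforce
      then show ?thesis by blast
    qed
  qed
  then obtain q where Q: "\<And>n. Q n (q n)" and gap: "\<And>n. gap (q n) (q (Suc n))" by blast
  define x where "x n = fst (q n)" for n
  define x' where "x' n = snd (q n)" for n
  have x_ne: "x n \<noteq> x' n" and x_r: "dist (x n) (x' n) \<le> r" and w_x: "w (x n) \<ge> 2 ^ n" for n
    using Q[of n] by (auto simp: Q_def x_def x'_def)
  define m where "m n = min (dist p0 (\<tau> (x n))) (dist p0 (\<tau> (x' n)))" for n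
  define M where "M n = max (dist p0 (\<tau> (x n))) (dist p0 (\<tau> (x' n)))" for n
  have mM: "M n + 1 \<le> m (Suc n)" for n
    using gap[of n] by (auto simp: gap_def m_def M_def x_def x'_def)
  have mM': "M i + 1 \<le> m j" if "i < j" for i j
    using that
  proof (induction rule: strict_inc_induct)
    case (base i) then show ?case using mM[of i] by simp
  next
    case (step i)
    have "m (Suc i) \<le> M (Suc i)" by (simp add: m_def M_def)
    then show ?case using step mM[of i] by linarith
  qed
  have sep: "dist (\<tau> (x n)) (\<tau> (x' k)) \<ge> 1" if "k \<noteq> n" for k n
  proof (cases "k < n")
    case True
    have "dist p0 (\<tau> (x' k)) + 1 \<le> dist p0 (\<tau> (x n))" using mM'[OF True] by (auto simp: m_def M_def)
    then show ?thesis using dist_triangle[of p0 "\<tau> (x n)" "\<tau> (x' k)"] by (simp add: dist_commute)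
  next
    case False
    then have "n < k" using that by simp
    have "dist p0 (\<tau> (x n)) + 1 \<le> dist p0 (\<tau> (x' k))" using mM'[OF \<open>n < k\<close>] by (auto simp: m_def M_def)
    then show ?thesis using dist_triangle[of p0 "\<tau> (x' k)" "\<tau> (x n)"] by simp
  qed
  have "summable (\<lambda>n. 1 / w (x n))"
  proof (rule summable_comparison_test'[of "\<lambda>n. (1/2) ^ n" 0])
    show "summable (\<lambda>n. (1/2::real) ^ n)" by (simp add: summable_geometric)
    show "norm (1 / w (x n)) \<le> (1/2) ^ n" for n
      using w_x[of n] w_pos[of "x n"] by (simp add: power_one_over field_simps)
  qed
  moreover have "\<tau> (x n) \<noteq> \<tau> (x' n)" for n using \<tau>_inj x_ne by blast
  ultimately obtain f where f: "f \<in> SO" "\<And>n. f (\<tau> (x n)) \<ge> 1 / w (x n)" "\<And>n. f (\<tau> (x' n)) = 0"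
    using SO_gliding_hump[OF PY, of "\<lambda>n. 1 / w (x n)" "\<lambda>n. \<tau> (x n)" "\<lambda>n. \<tau> (x' n)"] sep w_pos
    by (metis less_imp_le zero_less_divide_1_iff)
  have Tf: "T f (x n) \<ge> 1" "T f (x' n) = 0" for n
    using T_eq[OF f(1)] f(2)[of n] f(3)[of n] w_pos[of "x n"] by (auto simp: field_simps)
  obtain K where K: "compact K" "\<And>x y. x \<notin> K \<Longrightarrow> dist x y \<le> r \<Longrightarrow> \<bar>T f x - T f y\<bar> < 1"
    using SO_oscE[OF PX SO_isosD(1)[OF T f(1)] r(1), of 1] by auto
  have "bounded (w ` K)"
    using K(1) SO_continuous[OF w_SO]
    by (intro compact_imp_bounded compact_continuous_image) (auto intro: continuous_on_subset)
  then obtain A where A: "\<forall>x\<in>K. \<bar>w x\<bar> \<le> A" by (auto simp: bounded_iff)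
  obtain n where "A < 2 ^ n" using real_arch_pow[of 2 A] by auto
  then have "x n \<notin> K" using A w_x[of n] by force
  then show False using K(2)[OF _ x_r[of n]] Tf[of n] by force
qed

section \<open>Restriction to bounded functions\<close>

lemma SO_bdd_iff: "f \<in> SO_bdd \<longleftrightarrow> f \<in> SO \<and> (\<exists>B. \<forall>x. \<bar>f x\<bar> \<le> B)"
  by (auto simp: SO_bdd_def bounded_iff)

lemma SO_isos_preserves_bounded:
  fixes T :: "('b::metric_space \<Rightarrow> real) \<Rightarrow> ('a::metric_space \<Rightarrow> real)"
  assumes PX: "proper_space TYPE('a)" and CX: "chain_connected TYPE('a)"
    and PY: "proper_space TYPE('b)" and T: "T \<in> SO_isos" and f: "f \<in> SO_bdd"
  shows "T f \<in> SO_bdd"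
proof -
  obtain \<tau> where \<tau>: "\<forall>f\<in>SO. \<forall>x. T f x = T (\<lambda>_. 1) x * f (\<tau> x)"
    using SO_isos_weighted_composition[OF PX PY T] by (rule exE)
  note T_eq = \<tau>[rule_format]
  obtain C where C: "\<And>x. \<bar>T (\<lambda>_. 1) x\<bar> \<le> C"
    using SO_isos_weight_bounded[OF PX CX PY T] by (auto simp: bounded_iff)
  obtain B where fB: "f \<in> SO" "\<And>y. \<bar>f y\<bar> \<le> B" using f by (auto simp: SO_bdd_iff)
  have "\<bar>T f x\<bar> \<le> C * B" for x
    unfolding T_eq[OF fB(1), of x] abs_mult using C[of x] fB(2)[of "\<tau> x"] by (intro mult_mono) auto
  then show ?thesis using SO_isosD(1)[OF T fB(1)] by (auto simp: SO_bdd_iff)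
qed

lemma SO_isos_restrict:
  fixes T :: "('b::metric_space \<Rightarrow> real) \<Rightarrow> ('a::metric_space \<Rightarrow> real)"
  assumes PX: "proper_space TYPE('a)" and CX: "chain_connected TYPE('a)"
    and PY: "proper_space TYPE('b)" and CY: "chain_connected TYPE('b)" and T: "T \<in> SO_isos"
  shows "restrict T SO_bdd \<in> SO_bdd_isos"
proof -
  obtain S where S: "S \<in> SO_isos" and inv: "(\<forall>f\<in>SO. T (S f) = f) \<and> (\<forall>f\<in>SO. S (T f) = f)"
    using SO_isos_inverse[OF PY PX T] by (rule bexE)
  note TB = SO_isos_preserves_bounded[OF PX CX PY T]
  note SB = SO_isos_preserves_bounded[OF PY CY PX S]
  have bij: "bij_betw T SO_bdd SO_bdd"
    by (rule bij_betw_byWitness[where f' = S]) (use TB SB inv in \<open>auto simp: SO_bdd_iff\<close>)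
  have add: "(\<lambda>x. f x + g x) \<in> SO_bdd" if fb: "f \<in> SO_bdd" "g \<in> SO_bdd" for f g :: "'b \<Rightarrow> real"
  proof -
    obtain A where A: "\<forall>x. \<bar>f x\<bar> \<le> A" using fb(1) unfolding SO_bdd_iff by blast
    obtain B where B: "\<forall>x. \<bar>g x\<bar> \<le> B" using fb(2) unfolding SO_bdd_iff by blast
    from A B have "\<forall>x. \<bar>f x + g x\<bar> \<le> A + B" by (meson abs_triangle_ineq add_mono order_trans)
    then show ?thesis using fb SO_add[OF PY] by (auto simp: SO_bdd_iff)
  qed
  have scale: "(\<lambda>x. c * f x) \<in> SO_bdd" if fb: "f \<in> SO_bdd" for f :: "'b \<Rightarrow> real" and c
  proof -
    obtain A where "\<forall>x. \<bar>f x\<bar> \<le> A" using fb unfolding SO_bdd_iff by blast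
    then have "\<forall>x. \<bar>c * f x\<bar> \<le> \<bar>c\<bar> * A" by (simp add: abs_mult mult_left_mono)
    then show ?thesis using fb SO_scale[OF PY] by (auto simp: SO_bdd_iff)
  qed
  have mx: "(\<lambda>x. max (f x) (g x)) \<in> SO_bdd" and mn: "(\<lambda>x. min (f x) (g x)) \<in> SO_bdd"
    if fb: "f \<in> SO_bdd" "g \<in> SO_bdd" for f g :: "'b \<Rightarrow> real"
  proof -
    obtain A where A: "\<forall>x. \<bar>f x\<bar> \<le> A" using fb(1) unfolding SO_bdd_iff by blast
    obtain B where B: "\<forall>x. \<bar>g x\<bar> \<le> B" using fb(2) unfolding SO_bdd_iff by blast
    have "\<forall>x. \<bar>max (f x) (g x)\<bar> \<le> max A B" "\<forall>x. \<bar>min (f x) (g x)\<bar> \<le> max A B"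
      using A B by (smt (verit))+
    then show "(\<lambda>x. max (f x) (g x)) \<in> SO_bdd" "(\<lambda>x. min (f x) (g x)) \<in> SO_bdd"
      using fb SO_max[OF PY] SO_min[OF PY] by (auto simp: SO_bdd_iff)
  qed
  have sub: "f \<in> SO" if "f \<in> SO_bdd" for f :: "'b \<Rightarrow> real" using that by (simp add: SO_bdd_iff)
  show ?thesis unfolding SO_bdd_isos_def lattice_isos_def
  proof (intro CollectI conjI ballI allI)
    show "restrict T SO_bdd \<in> SO_bdd \<rightarrow>\<^sub>E SO_bdd" using TB by auto
    show "bij_betw (restrict T SO_bdd) SO_bdd SO_bdd" using bij by (simp cong: bij_betw_cong)
  qed (simp_all only: restrict_apply' add scale mx mn sub SO_isosD(4-7)[OF T])
qed

lemma SO_isos_restrict_inj: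
  fixes T T' :: "('b::metric_space \<Rightarrow> real) \<Rightarrow> ('a::metric_space \<Rightarrow> real)"
  assumes PX: "proper_space TYPE('a)" and PY: "proper_space TYPE('b)"
    and T: "T \<in> SO_isos" and T': "T' \<in> SO_isos"
    and eq: "restrict T SO_bdd = restrict T' SO_bdd"
  shows "T = T'"
proof (rule extensionalityI[OF SO_isosD(3)[OF T] SO_isosD(3)[OF T']])
  fix f :: "'b \<Rightarrow> real" assume f: "f \<in> SO"
  have eq': "T g = T' g" if "g \<in> SO_bdd" for g using eq that by (metis restrict_apply')
  have one: "T (\<lambda>_. 1) = T' (\<lambda>_. 1)"
    by (rule eq') (use SO_const[OF PY] in \<open>auto simp: SO_bdd_iff\<close>)
  have pos: "T (\<lambda>_. 1) x > 0" for x by (rule SO_isos_one_pos[OF PX PY T])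
  obtain \<tau> where \<tau>: "\<forall>f\<in>SO. \<forall>x. T f x = T (\<lambda>_. 1) x * f (\<tau> x)"
    using SO_isos_weighted_composition[OF PX PY T] by (rule exE)
  note T_eq = \<tau>[rule_format]
  obtain \<sigma> where \<sigma>: "\<forall>f\<in>SO. \<forall>x. T' f x = T' (\<lambda>_. 1) x * f (\<sigma> x)"
    using SO_isos_weighted_composition[OF PX PY T'] by (rule exE)
  note T'_eq = \<sigma>[rule_format]
  show "T f = T' f"
  proof
    fix x
    \<comment> \<open>Truncation at a level that leaves \<open>f\<close> unchanged at both points of evaluation.\<close>
    define N where "N = max \<bar>f (\<tau> x)\<bar> \<bar>f (\<sigma> x)\<bar>"
    define g where "g = (\<lambda>y. max (- N) (min N (f y)))"
    have g: "g \<in> SO" unfolding g_def by (intro SO_max[OF PY] SO_min[OF PY] SO_const[OF PY] f)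
    have "N \<ge> 0" by (simp add: N_def le_max_iff_disj)
    then have "\<forall>y. \<bar>g y\<bar> \<le> N" by (auto simp: g_def max_def min_def)
    then have "g \<in> SO_bdd" using g unfolding SO_bdd_iff by blast
    then have "T g x = T' g x" using eq' by simp
    then have "g (\<tau> x) = g (\<sigma> x)" using T_eq[OF g] T'_eq[OF g] one pos[of x] by simp
    moreover have "g (\<tau> x) = f (\<tau> x)" "g (\<sigma> x) = f (\<sigma> x)" by (auto simp: g_def N_def)
    ultimately show "T f x = T' f x" using T_eq[OF f] T'_eq[OF f] one by simp
  qed
qed

section \<open>Multipliers\<close>

lemma SO_sharp_multiplication_iso:
  fixes \<omega> :: "'a::metric_space \<Rightarrow> real"
  assumes P: "proper_space TYPE('a)" and \<omega>: "\<omega> \<in> SO_sharp"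
  shows "restrict (\<lambda>f x. \<omega> x * f x) SO \<in> SO_isos" (is "?T \<in> _")
proof -
  have pos: "\<omega> x > 0" for x
    using \<omega> by (simp add: SO_sharp_def sharp_def)
  have mult: "(\<lambda>x. \<omega> x * f x) \<in> SO" "(\<lambda>x. (1 / \<omega> x) * f x) \<in> SO" if "f \<in> SO" for f
    using \<omega> that unfolding SO_sharp_def sharp_def by blast+
  have nz: "\<omega> x \<noteq> 0" for x using pos[of x] by simp
  have bij: "bij_betw (\<lambda>f x. \<omega> x * f x) SO SO"
    by (rule bij_betw_byWitness[where f' = "\<lambda>f x. (1 / \<omega> x) * f x"]) (use mult nz in auto)
  have distr: "\<omega> x * max s t = max (\<omega> x * s) (\<omega> x * t)"
    "\<omega> x * min s t = min (\<omega> x * s) (\<omega> x * t)" for x s t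
    using pos[of x] by (simp_all add: max_mult_distrib_left min_mult_distrib_left)
  show ?thesis unfolding SO_isos_def lattice_isos_def
  proof (intro CollectI conjI ballI allI)
    show "?T \<in> SO \<rightarrow>\<^sub>E SO" using mult(1) by auto
    show "bij_betw ?T SO SO" using bij by (simp cong: bij_betw_cong)
  qed (simp_all add: SO_add[OF P] SO_scale[OF P] SO_max[OF P] SO_min[OF P] distr distrib_left mult.left_commute)
qed

text \<open>The restriction of multiplication by \<open>\<omega>\<close> is a bijection of the bounded functions; its inverse is
  multiplication by \<open>1 / \<omega>\<close>.\<close>

lemma SO_sharp_subset_SO_bdd_sharp:
  assumes P: "proper_space TYPE('a::metric_space)" and C: "chain_connected TYPE('a)"
  shows "(SO_sharp :: ('a \<Rightarrow> real) set) \<subseteq> SO_bdd_sharp"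
proof
  fix \<omega> :: "'a \<Rightarrow> real" assume \<omega>: "\<omega> \<in> SO_sharp"
  define T where "T = restrict (\<lambda>f x. \<omega> x * f x) (SO :: ('a \<Rightarrow> real) set)"
  have pos: "\<omega> x > 0" for x using \<omega> by (simp add: SO_sharp_def sharp_def)
  have T: "T \<in> SO_isos" unfolding T_def by (rule SO_sharp_multiplication_iso[OF P \<omega>])
  have T_app: "T f = (\<lambda>x. \<omega> x * f x)" if "f \<in> SO_bdd" for f
    using that by (simp add: T_def SO_bdd_def)
  have bij: "bij_betw T SO_bdd SO_bdd"
    using SO_isos_restrict[OF P C P C T] unfolding SO_bdd_isos_def lattice_isos_def
    by (simp cong: bij_betw_cong)
  have one: "(\<lambda>_::'a. 1) \<in> SO_bdd" using SO_const[OF P] by (auto simp: SO_bdd_iff)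
  have mult: "(\<lambda>x. \<omega> x * f x) \<in> SO_bdd" if "f \<in> SO_bdd" for f
    using bij_betwE[OF bij, rule_format, OF that] unfolding T_app[OF that] .
  have dv: "(\<lambda>x. (1 / \<omega> x) * f x) \<in> SO_bdd" if "f \<in> SO_bdd" for f
  proof -
    have "f \<in> T ` SO_bdd" using bij_betw_imp_surj_on[OF bij] that by simp
    then obtain g where g: "f = T g" "g \<in> SO_bdd" by (rule imageE)
    have "(\<lambda>x. (1 / \<omega> x) * f x) = g"
      unfolding g(1) T_app[OF g(2)] using pos by (simp add: fun_eq_iff less_imp_neq[symmetric])
    then show ?thesis using g by simp
  qed
  show "\<omega> \<in> SO_bdd_sharp"
    unfolding SO_bdd_sharp_def sharp_def using mult[OF one] mult dv pos by simp
qed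

text \<open>Multiplication by a nonnegative function commutes with \<open>max\<close> and \<open>min\<close>, and a general function is
  a difference of two nonnegative ones.\<close>

lemma SO_mult_nonnegI:
  fixes u :: "'a::metric_space \<Rightarrow> real"
  assumes P: "proper_space TYPE('a)" and f: "f \<in> SO"
    and nn: "\<And>g. g \<in> SO \<Longrightarrow> (\<And>x. g x \<ge> 0) \<Longrightarrow> (\<lambda>x. u x * g x) \<in> SO"
  shows "(\<lambda>x. u x * f x) \<in> SO"
proof -
  have "(\<lambda>x. u x * max 0 (f x) - u x * max 0 (-1 * f x)) \<in> SO"
    by (intro SO_diff[OF P] nn SO_max[OF P] SO_const[OF P] SO_scale[OF P] f) auto
  moreover have "(\<lambda>x. u x * max 0 (f x) - u x * max 0 (-1 * f x)) = (\<lambda>x. u x * f x)"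
    by (auto simp: max_def)
  ultimately show ?thesis by simp
qed

lemma SO_sharp_lattice:
  fixes u v :: "'a::metric_space \<Rightarrow> real"
  assumes P: "proper_space TYPE('a)" and u: "u \<in> SO_sharp" and v: "v \<in> SO_sharp"
  shows "(\<lambda>x. min (u x) (v x)) \<in> SO_sharp" "(\<lambda>x. max (u x) (v x)) \<in> SO_sharp"
proof -
  have SO: "u \<in> SO" "v \<in> SO" and pos: "u x > 0" "v x > 0" for x
    using u v by (auto simp: SO_sharp_def sharp_def)
  have m: "(\<lambda>x. u x * f x) \<in> SO" "(\<lambda>x. (1 / u x) * f x) \<in> SO"
    "(\<lambda>x. v x * f x) \<in> SO" "(\<lambda>x. (1 / v x) * f x) \<in> SO" if "f \<in> SO" for f
    using u v that unfolding SO_sharp_def sharp_def by blast+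
  have inv: "1 / min (u x) (v x) = max (1 / u x) (1 / v x)"
    "1 / max (u x) (v x) = min (1 / u x) (1 / v x)" for x
    using pos[of x] by (auto simp: min_def max_def field_simps)
  have mn: "(\<lambda>x. min (a x) (b x) * f x) \<in> SO" and mx: "(\<lambda>x. max (a x) (b x) * f x) \<in> SO"
    if "\<And>f. f \<in> SO \<Longrightarrow> (\<lambda>x. a x * f x) \<in> SO" "\<And>f. f \<in> SO \<Longrightarrow> (\<lambda>x. b x * f x) \<in> SO" "f \<in> SO"
    for a b f :: "'a \<Rightarrow> real"
  proof -
    show "(\<lambda>x. min (a x) (b x) * f x) \<in> SO"
    proof (rule SO_mult_nonnegI[OF P that(3)])
      fix g :: "'a \<Rightarrow> real" assume g: "g \<in> SO" "\<And>x. g x \<ge> 0"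
      show "(\<lambda>x. min (a x) (b x) * g x) \<in> SO"
        using SO_min[OF P that(1,2)[OF g(1)]] g(2) by (simp add: min_mult_distrib_right)
    qed
    show "(\<lambda>x. max (a x) (b x) * f x) \<in> SO"
    proof (rule SO_mult_nonnegI[OF P that(3)])
      fix g :: "'a \<Rightarrow> real" assume g: "g \<in> SO" "\<And>x. g x \<ge> 0"
      show "(\<lambda>x. max (a x) (b x) * g x) \<in> SO"
        using SO_max[OF P that(1,2)[OF g(1)]] g(2) by (simp add: max_mult_distrib_right)
    qed
  qed
  show "(\<lambda>x. min (u x) (v x)) \<in> SO_sharp" "(\<lambda>x. max (u x) (v x)) \<in> SO_sharp"
    unfolding SO_sharp_def sharp_def mem_Collect_eq inv
    using SO_min[OF P SO] SO_max[OF P SO] pos mn[OF m(1,3)] mx[OF m(1,3)] mn[OF m(2,4)] mx[OF m(2,4)]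
    by (simp_all add: less_max_iff_disj)
qed

theorem corollary4p12:
  assumes "proper_space TYPE('a::metric_space)"
    and "chain_connected TYPE('a)"
    and "\<not> bounded (UNIV :: 'a set)"
    and "proper_space TYPE('b::metric_space)"
    and "chain_connected TYPE('b)"
    and "\<not> bounded (UNIV :: 'b set)"
  shows "(\<lambda>T. restrict T SO_bdd) \<in>
           (SO_isos :: (('b \<Rightarrow> real) \<Rightarrow> ('a \<Rightarrow> real)) set) \<rightarrow> SO_bdd_isos
       \<and> inj_on (\<lambda>T. restrict T SO_bdd) (SO_isos :: (('b \<Rightarrow> real) \<Rightarrow> ('a \<Rightarrow> real)) set)
       \<and> sublattice_of (SO_sharp :: ('a \<Rightarrow> real) set) SO_bdd_sharp"
proof (intro conjI)
  note PX = assms(1) and CX = assms(2) and PY = assms(4) and CY = assms(5)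
  show "(\<lambda>T. restrict T SO_bdd) \<in> (SO_isos :: (('b \<Rightarrow> real) \<Rightarrow> ('a \<Rightarrow> real)) set) \<rightarrow> SO_bdd_isos"
    using SO_isos_restrict[OF PX CX PY CY] by blast
  show "inj_on (\<lambda>T. restrict T SO_bdd) (SO_isos :: (('b \<Rightarrow> real) \<Rightarrow> ('a \<Rightarrow> real)) set)"
    using SO_isos_restrict_inj[OF PX PY] by (intro inj_onI) blast
  show "sublattice_of (SO_sharp :: ('a \<Rightarrow> real) set) SO_bdd_sharp"
    unfolding sublattice_of_def
    using SO_sharp_subset_SO_bdd_sharp[OF PX CX] SO_sharp_lattice[OF PX] by blast
qed

end
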